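(* Let $\alpha>-1$, $\beta>-1$ be real numbers and let $n$ be a nonnegative integer. For all integers $k,l$ with $0\le k,l\le n$, the alternative Jacobi polynomials satisfy $$\int_0^1 x^\alpha(1-x)^\beta\,{\cal P}_{nk}^{(\alpha,\beta)}(x)\,{\cal P}_{nl}^{(\alpha,\beta)}(x)\,dx=h_{nk}^{(\alpha,\beta)}\,\delta_{kl},$$ where $$h_{nk}^{(\alpha,\beta)}=\frac{1}{\alpha+2k+1}\,\frac{\Gamma(\alpha+n+k+2)\,\Gamma(\beta+n-k+1)}{(n-k)!\,\Gamma(\alpha+\beta+n+k+2)} .$$
   Context: For a nonnegative integer $n$, $0\le k\le n$, and real $\alpha>-1$, $\beta>-1$, the alternative Jacobi polynomials are defined by the Rodrigues-type formula $${\cal P}_{nk}^{(\alpha,\beta)}(x)=\frac{x^{-\alpha-k-1}(1-x)^{-\beta}}{(n-k)!}\frac{d^{\,n-k}}{dx^{\,n-k}}\left(x^{\alpha+n+k+1}(1-x)^{\beta+n-k}\right),\qquad 0<x<1,$$ which is (the restriction of) a polynomial in $x$. Here $\delta_{kl}$ is the Kronecker delta and $\Gamma$ is the gamma function. *)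

theory Defs
  imports "HOL-Analysis.Analysis"
begin

text \<open>The Rodrigues-type formula is meaningful for \<open>k \<le> n\<close> and \<open>0 < x < 1\<close> only; the polynomial
  is represented by its values there, and nothing is claimed about the function elsewhere.\<close>

definition alt_jacobi :: "real \<Rightarrow> real \<Rightarrow> nat \<Rightarrow> nat \<Rightarrow> real \<Rightarrow> real" where
  "alt_jacobi \<alpha> \<beta> n k x =
     x powr (- \<alpha> - real k - 1) * (1 - x) powr (- \<beta>) / fact (n - k) *
     (deriv ^^ (n - k))
       (\<lambda>t. t powr (\<alpha> + real n + real k + 1) * (1 - t) powr (\<beta> + real n - real k)) x"

definition alt_jacobi_norm :: "real \<Rightarrow> real \<Rightarrow> nat \<Rightarrow> nat \<Rightarrow> real" where
  "alt_jacobi_norm \<alpha> \<beta> n k =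
     1 / (\<alpha> + 2 * real k + 1) *
     (Gamma (\<alpha> + real n + real k + 2) * Gamma (\<beta> + real n - real k + 1) /
      (fact (n - k) * Gamma (\<alpha> + \<beta> + real n + real k + 2)))"

end

theory Submission
  imports Defs
begin

text \<open>By the Leibniz rule \<open>P\<^bsub>nk\<^esub>(x) = x\<^sup>k q(x)\<close>, where \<open>q\<close> is the Jacobi polynomial of degree
  \<open>m = n - k\<close> for the weight \<open>x\<^sup>a (1 - x)\<^sup>b\<close> on \<open>(0, 1)\<close>, with \<open>a = \<alpha> + 2k + 1\<close> and \<open>b = \<beta>\<close>.
  Beta integrals and Vandermonde's identity give the moments
  \<open>\<integral> x\<^bsup>s-1\<^esup> (1 - x)\<^sup>b q(x) dx = B(s, b + m + 1) (a + m - s gchoose m)\<close>. For \<open>s = a + i\<close> with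
  \<open>0 < i \<le> m\<close> they vanish, so for every polynomial \<open>p\<close> of degree at most \<open>m\<close> the integral of
  \<open>x\<^bsup>a-1\<^esup> (1 - x)\<^sup>b q(x) p(x)\<close> is \<open>p(0) B(a, b + m + 1)\<close>. For \<open>k \<le> l\<close> the integral in question is
  of this form with \<open>p(x) = x\<^bsup>-k\<^esup> P\<^bsub>nl\<^esub>(x)\<close>, and \<open>p(0) = 0\<close> unless \<open>k = l\<close>.\<close>

section \<open>Leibniz expansion of the Rodrigues formula\<close>

lemma Suc_times_gbinomial_Suc:
  fixes a :: real
  shows "(a gchoose k) * (a - real k) = real (Suc k) * (a gchoose Suc k)"
  using gbinomial_mult_1[of a k] by (simp add: algebra_simps)

text \<open>Induction step of the Leibniz rule, for the m-th derivative divided by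
  \<open>fact m\<close>. Differentiating summand \<open>j\<close> feeds the new summands
  \<open>Suc j\<close> and \<open>j\<close> with weights \<open>Suc j\<close> and
  \<open>Suc m - j\<close>; the minus sign from \<open>1 - x\<close> is absorbed by the new power of
  -1. Each new summand thus collects the total weight \<open>Suc m\<close>.\<close>

lemma deriv_sum_powr_mult_one_minus_powr:
  fixes A B x :: real
  assumes "0 < x" "x < 1"
  shows "((\<lambda>x. \<Sum>j\<le>m. (-1) ^ (m - j) * (A gchoose j) * (B gchoose (m - j)) *
             (x powr (A - real j) * (1 - x) powr (B - real (m - j)))) has_real_derivative
          real (Suc m) * (\<Sum>j\<le>Suc m. (-1) ^ (Suc m - j) * (A gchoose j) * (B gchoose (Suc m - j)) *
             (x powr (A - real j) * (1 - x) powr (B - real (Suc m - j))))) (at x)"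
proof -
  define T where "T j = (-1) ^ (Suc m - j) * (A gchoose j) * (B gchoose (Suc m - j)) *
             (x powr (A - real j) * (1 - x) powr (B - real (Suc m - j)))" for j
  have term_deriv: "((\<lambda>x. (-1) ^ (m - j) * (A gchoose j) * (B gchoose (m - j)) *
             (x powr (A - real j) * (1 - x) powr (B - real (m - j)))) has_real_derivative
           real (Suc j) * T (Suc j) + real (Suc m - j) * T j) (at x)" (is "(?f has_real_derivative _) _")
    if "j \<le> m" for j
  proof -
    have powr: "((\<lambda>x. x powr c) has_real_derivative c * x powr (c - 1)) (at x)" for c
      using assms by (intro has_real_derivative_powr) auto
    have one_minus_powr: "((\<lambda>x. (1 - x) powr c) has_real_derivative - (c * (1 - x) powr (c - 1))) (at x)" for c
      using assms by (auto intro!: derivative_eq_intros simp: powr_diff)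
    have "(?f has_real_derivative
        (-1) ^ (m - j) * (A gchoose j) * (B gchoose (m - j)) *
         ((A - real j) * x powr (A - real j - 1) * (1 - x) powr (B - real (m - j))
          - x powr (A - real j) * ((B - real (m - j)) * (1 - x) powr (B - real (m - j) - 1)))) (at x)"
      by (rule DERIV_cong[OF DERIV_cmult[OF DERIV_mult[OF powr one_minus_powr]]])
        (simp add: algebra_simps)
    moreover have "(-1) ^ (m - j) * (A gchoose j) * (B gchoose (m - j)) *
         ((A - real j) * x powr (A - real j - 1) * (1 - x) powr (B - real (m - j)))
       = (-1) ^ (m - j) * ((A gchoose j) * (A - real j)) * (B gchoose (m - j)) *
         (x powr (A - real j - 1) * (1 - x) powr (B - real (m - j)))"
      by (simp only: mult_ac)
    moreover have "\<dots> = real (Suc j) * T (Suc j)"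
      unfolding Suc_times_gbinomial_Suc T_def by (simp add: algebra_simps)
    moreover have "(-1) ^ (m - j) * (A gchoose j) * (B gchoose (m - j)) *
         (x powr (A - real j) * ((B - real (m - j)) * (1 - x) powr (B - real (m - j) - 1)))
       = (-1) ^ (m - j) * (A gchoose j) * ((B gchoose (m - j)) * (B - real (m - j))) *
         (x powr (A - real j) * (1 - x) powr (B - real (m - j) - 1))"
      by (simp only: mult_ac)
    moreover have "\<dots> = - (real (Suc m - j) * T j)"
      unfolding Suc_times_gbinomial_Suc T_def using that
      by (simp add: Suc_diff_le algebra_simps)
    ultimately show ?thesis
      by (simp only: right_diff_distrib diff_minus_eq_add)
  qed
  have "(\<Sum>j\<le>m. real (Suc j) * T (Suc j) + real (Suc m - j) * T j)
      = (\<Sum>j\<le>m. real (Suc j) * T (Suc j)) + (\<Sum>j\<le>m. real (Suc m - j) * T j)"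
    by (rule sum.distrib)
  \<comment> \<open>After the index shift both sums extend to \<open>j \<le> Suc m\<close> at no
    cost: the weight of the added term is 0, at \<open>j = 0\<close> here and at
    \<open>j = Suc m\<close> in the next step.\<close>
  also have "(\<Sum>j\<le>m. real (Suc j) * T (Suc j)) = (\<Sum>j\<le>Suc m. real j * T j)"
    by (subst sum.atMost_Suc_shift) simp
  also have "(\<Sum>j\<le>m. real (Suc m - j) * T j) = (\<Sum>j\<le>Suc m. real (Suc m - j) * T j)"
    by simp
  also have "(\<Sum>j\<le>Suc m. real j * T j) + \<dots> = (\<Sum>j\<le>Suc m. real (Suc m) * T j)"
    unfolding sum.distrib[symmetric]
    by (rule sum.cong) (auto simp: of_nat_diff algebra_simps)
  finally have sum_eq: "(\<Sum>j\<le>m. real (Suc j) * T (Suc j) + real (Suc m - j) * T j)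
      = real (Suc m) * (\<Sum>j\<le>Suc m. T j)"
    by (simp only: sum_distrib_left)
  show ?thesis
    unfolding T_def[symmetric] sum_eq[symmetric]
    by (rule DERIV_sum) (use term_deriv in auto)
qed

lemma higher_deriv_powr_mult_one_minus_powr:
  fixes A B x :: real
  assumes "0 < x" "x < 1"
  shows "(deriv ^^ m) (\<lambda>t. t powr A * (1 - t) powr B) x =
     fact m * (\<Sum>j\<le>m. (-1) ^ (m - j) * (A gchoose j) * (B gchoose (m - j)) *
        (x powr (A - real j) * (1 - x) powr (B - real (m - j))))"
  using assms
proof (induction m arbitrary: x)
  case 0
  then show ?case by simp
next
  case (Suc m)
  let ?S = "\<lambda>m x. \<Sum>j\<le>m. (-1) ^ (m - j) * (A gchoose j) * (B gchoose (m - j)) *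
        (x powr (A - real j) * (1 - x) powr (B - real (m - j)))"
  \<comment> \<open>To differentiate the induction hypothesis at \<open>x\<close>, it must hold on a
    neighbourhood of \<open>x\<close>; it does because (0,1) is open.\<close>
  have "\<forall>\<^sub>F y in nhds x. y \<in> {0<..<1}"
    using Suc.prems by (intro eventually_nhds_in_open) auto
  then have "\<forall>\<^sub>F y in nhds x. (deriv ^^ m) (\<lambda>t. t powr A * (1 - t) powr B) y = fact m * ?S m y"
    by eventually_elim (use Suc.IH in auto)
  then have "(deriv ^^ Suc m) (\<lambda>t. t powr A * (1 - t) powr B) x = deriv (\<lambda>y. fact m * ?S m y) x"
    by (simp add: deriv_cong_ev)
  also have "\<dots> = fact m * (real (Suc m) * ?S (Suc m) x)"
    by (rule DERIV_imp_deriv, rule DERIV_cmult)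
      (rule deriv_sum_powr_mult_one_minus_powr[OF Suc.prems])
  finally show ?case by (simp only: fact_Suc mult_ac of_nat_mult)
qed

text \<open>The classical Jacobi polynomial with parameters \<open>a\<close>, \<open>b\<close>,
  taken at 1 - 2x. Index \<open>j\<close> counts the derivatives that fall on the power of x in the
  Leibniz rule.\<close>

definition jacobi01 :: "real \<Rightarrow> real \<Rightarrow> nat \<Rightarrow> real poly" where
  "jacobi01 a b m = (\<Sum>j\<le>m. smult ((-1) ^ (m - j) * (a + real m gchoose j) * (b + real m gchoose (m - j)))
     (monom 1 (m - j) * [:1, -1:] ^ j))"

lemma poly_jacobi01:
  "poly (jacobi01 a b m) x = (\<Sum>j\<le>m. (-1) ^ (m - j) * (a + real m gchoose j) *
     (b + real m gchoose (m - j)) * (x ^ (m - j) * (1 - x) ^ j))"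
  by (simp add: jacobi01_def poly_sum poly_monom)

lemma degree_jacobi01: "degree (jacobi01 a b m) \<le> m"
  unfolding jacobi01_def
proof (intro degree_sum_le)
  fix j assume "j \<in> {..m}"
  have "degree (monom 1 (m - j) * [:1, -1:] ^ j :: real poly) \<le>
      degree (monom 1 (m - j) :: real poly) + degree ([:1, -1:] ^ j :: real poly)"
    by (rule degree_mult_le)
  also have "\<dots> \<le> (m - j) + j"
    by (intro add_mono degree_monom_le order.trans[OF degree_power_le]) simp
  also have "\<dots> = m"
    using \<open>j \<in> {..m}\<close> by simp
  finally show "degree (smult ((-1) ^ (m - j) * (a + real m gchoose j) * (b + real m gchoose (m - j)))
      (monom 1 (m - j) * [:1, -1:] ^ j)) \<le> m"
    by (rule order.trans[OF degree_smult_le])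
qed simp

lemma gbinomial_Gamma_real:
  fixes a :: real
  assumes "a > -1"
  shows "(a + real i gchoose i) = Gamma (a + real i + 1) / (Gamma (a + 1) * fact i)"
proof -
  have "a + 1 \<notin> \<int>\<^sub>\<le>\<^sub>0"
    using assms by (auto elim!: nonpos_Ints_cases)
  then show ?thesis
    by (simp add: gbinomial_pochhammer' pochhammer_Gamma add_ac)
qed

lemma poly_jacobi01_0:
  assumes "a > -1"
  shows "poly (jacobi01 a b m) 0 = Gamma (a + real m + 1) / (Gamma (a + 1) * fact m)"
proof -
  \<comment> \<open>At 0 the factor \<open>x ^ (m - j)\<close> kills every term but
    \<open>j = m\<close>.\<close>
  have "poly (jacobi01 a b m) 0 = (\<Sum>j\<le>m. if j = m then (a + real m gchoose m) else 0)"
    unfolding poly_jacobi01 by (intro sum.cong) (auto simp: power_0_left)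
  then show ?thesis
    using assms by (simp add: gbinomial_Gamma_real)
qed

text \<open>With a = \<alpha> + 2k + 1 and m = n - k, the differentiated function is x^(a+m)
  (1-x)^(\<beta>+m), as in the Rodrigues formula for \<open>jacobi01\<close>. The prefactor has
  x^(-\<alpha>-k-1) = x^k x^(-a), which leaves the extra x^k.\<close>

lemma alt_jacobi_eq_poly:
  assumes "k \<le> n" "0 < x" "x < 1"
  shows "alt_jacobi \<alpha> \<beta> n k x = x ^ k * poly (jacobi01 (\<alpha> + 2 * real k + 1) \<beta> (n - k)) x"
proof -
  define m where "m = n - k"
  have n: "real n = real m + real k"
    using assms(1) by (simp add: m_def)
  have AB: "\<alpha> + real n + real k + 1 = \<alpha> + 2 * real k + 1 + real m" "\<beta> + real n - real k = \<beta> + real m"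
    by (simp_all add: n)
  have summand: "x powr (- \<alpha> - real k - 1) * (1 - x) powr (- \<beta>) *
      (c * (x powr (\<alpha> + 2 * real k + 1 + real m - real j) * (1 - x) powr (\<beta> + real m - real (m - j))))
    = x ^ k * (c * (x ^ (m - j) * (1 - x) ^ j))" if "j \<le> m" for j c
  proof -
    have "x powr (- \<alpha> - real k - 1) * x powr (\<alpha> + 2 * real k + 1 + real m - real j)
        = x powr real (k + (m - j))"
      using that by (simp add: powr_add[symmetric] of_nat_diff add_diff_eq)
    then have 1: "x powr (- \<alpha> - real k - 1) * x powr (\<alpha> + 2 * real k + 1 + real m - real j) = x ^ k * x ^ (m - j)"
      using assms by (simp add: powr_realpow power_add del: of_nat_add)
    have "(1 - x) powr (- \<beta>) * (1 - x) powr (\<beta> + real m - real (m - j)) = (1 - x) powr real j"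
      using that by (simp add: powr_add[symmetric] of_nat_diff)
    then have 2: "(1 - x) powr (- \<beta>) * (1 - x) powr (\<beta> + real m - real (m - j)) = (1 - x) ^ j"
      using assms by (simp add: powr_realpow)
    have "x powr (- \<alpha> - real k - 1) * (1 - x) powr (- \<beta>) *
      (c * (x powr (\<alpha> + 2 * real k + 1 + real m - real j) * (1 - x) powr (\<beta> + real m - real (m - j))))
      = c * (x powr (- \<alpha> - real k - 1) * x powr (\<alpha> + 2 * real k + 1 + real m - real j)) *
        ((1 - x) powr (- \<beta>) * (1 - x) powr (\<beta> + real m - real (m - j)))"
      by (simp only: mult_ac)
    then show ?thesis
      unfolding 1 2 by (simp only: mult_ac)
  qed
  have cancel: "u / fact m * (fact m * S) = u * S" for u S :: real
    by simp
  show ?thesis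
    unfolding alt_jacobi_def m_def[symmetric] AB poly_jacobi01
      higher_deriv_powr_mult_one_minus_powr[OF assms(2,3)] cancel sum_distrib_left
    by (intro sum.cong refl summand) simp
qed

section \<open>Beta integrals and moments of the Jacobi polynomials\<close>

lemma has_bochner_integral_Beta:
  fixes a b :: real
  assumes "a > 0" "b > 0"
  shows "has_bochner_integral lborel
     (\<lambda>x. indicator {0<..<1} x * (x powr (a - 1) * (1 - x) powr (b - 1))) (Beta a b)"
\<comment> \<open>The integrand is nonnegative, so the gauge integral determines the Lebesgue
  integral and yields integrability too.\<close>
proof (rule has_bochner_integral_nn_integral)
  have I: "((\<lambda>x. x powr (a - 1) * (1 - x) powr (b - 1)) has_integral Beta a b) {0<..<1}"
    using has_integral_Beta_real[OF assms] by (simp add: has_integral_Icc_iff_Ioo)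
  show "0 \<le> Beta a b"
    by (rule has_integral_nonneg[OF I]) simp
  show "(\<integral>\<^sup>+ x. ennreal (indicator {0<..<1} x * (x powr (a - 1) * (1 - x) powr (b - 1))) \<partial>lborel)
      = ennreal (Beta a b)"
    by (rule nn_integral_has_integral_lebesgue[OF _ I]) simp
qed auto

text \<open>Integrating termwise gives Beta values whose two arguments always add up to s + b + m +
  1. Hence \<open>Beta s (b + real m + 1)\<close> factors out; the rising factorial of s and the
  sign combine to \<open>- s gchoose (m - j)\<close>, and Vandermonde applies with upper entries a +
  m and -s.\<close>

lemma jacobi01_moment:
  assumes s: "s > 0" and b: "b > -1"
  shows "has_bochner_integral lborel
     (\<lambda>x. indicator {0<..<1} x * (x powr (s - 1) * (1 - x) powr b * poly (jacobi01 a b m) x))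
     (Beta s (b + real m + 1) * (a + real m - s gchoose m))"
proof -
  define c where "c j = (-1) ^ (m - j) * (a + real m gchoose j) * (b + real m gchoose (m - j))" for j
  have "has_bochner_integral lborel
     (\<lambda>x. \<Sum>j\<le>m. c j * (indicator {0<..<1} x *
         (x powr (s + real (m - j) - 1) * (1 - x) powr (b + real j + 1 - 1))))
     (\<Sum>j\<le>m. c j * Beta (s + real (m - j)) (b + real j + 1))"
    by (intro has_bochner_integral_sum has_bochner_integral_mult_right has_bochner_integral_Beta)
      (use s b in auto)
  also have "(\<lambda>x. \<Sum>j\<le>m. c j * (indicator {0<..<1} x *
         (x powr (s + real (m - j) - 1) * (1 - x) powr (b + real j + 1 - 1))))
    = (\<lambda>x. indicator {0<..<1} x * (x powr (s - 1) * (1 - x) powr b * poly (jacobi01 a b m) x))"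
    (is "?f = ?g")
  proof
    fix x :: real
    show "?f x = ?g x"
    proof (cases "x \<in> {0<..<1}")
      case True
      have "x powr (s + real i - 1) = x powr (s - 1) * x ^ i" for i
        using True powr_add[of x "s - 1" "real i"] by (simp add: powr_realpow algebra_simps)
      moreover have "(1 - x) powr (b + real j) = (1 - x) powr b * (1 - x) ^ j" for j
        using True by (simp add: powr_add powr_realpow)
      ultimately show ?thesis
        using True unfolding poly_jacobi01 c_def[symmetric]
        by (simp add: sum_distrib_left mult_ac del: of_nat_diff)
    qed simp
  qed
  also have "(\<Sum>j\<le>m. c j * Beta (s + real (m - j)) (b + real j + 1))
      = (\<Sum>j\<le>m. Beta s (b + real m + 1) * ((a + real m gchoose j) * (- s gchoose (m - j))))"
  proof (rule sum.cong)
    fix j assume "j \<in> {..m}"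
    then have j: "real (m - j) = real m - real j"
      by (simp add: of_nat_diff)
    have "s \<notin> \<int>\<^sub>\<le>\<^sub>0"
      using s by (auto elim!: nonpos_Ints_cases)
    then have s_choose: "(- s gchoose (m - j)) = (-1) ^ (m - j) * (Gamma (s + real (m - j)) / Gamma s) / fact (m - j)"
      by (simp add: gbinomial_pochhammer pochhammer_Gamma)
    have b_choose: "(b + real m gchoose (m - j)) = Gamma (b + real m + 1) / (Gamma (b + real j + 1) * fact (m - j))"
      using gbinomial_Gamma_real[of "b + real j" "m - j"] b by (simp add: j)
    have pos: "Gamma s > 0" "Gamma (b + real j + 1) > 0" "Gamma (s + (b + real m + 1)) > 0"
      using s b by (auto intro!: Gamma_real_pos)
    have "s + real (m - j) + (b + real j + 1) = s + (b + real m + 1)"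
      by (simp add: j)
    then show "c j * Beta (s + real (m - j)) (b + real j + 1)
        = Beta s (b + real m + 1) * ((a + real m gchoose j) * (- s gchoose (m - j)))"
      unfolding c_def s_choose b_choose Beta_def using pos by (simp add: field_simps)
  qed simp
  also have "\<dots> = Beta s (b + real m + 1) * (a + real m - s gchoose m)"
    using gbinomial_Vandermonde[of "a + real m" "- s" m]
    by (simp add: sum_distrib_left[symmetric] atMost_atLeast0)
  finally show ?thesis .
qed

text \<open>The weight exponent a - 1 is one below that of the Jacobi weight: writing p = p(0) + x
  r, orthogonality to r (degree below m) leaves the constant term. In the proof, the moment at s = a
  + i carries the factor (m - i choose m), which is 0 for 0 < i \<le> m and 1 for i = 0.\<close>

lemma jacobi01_integral:
  assumes a: "a > 0" and b: "b > -1" and deg: "degree p \<le> m"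
  shows "has_bochner_integral lborel
     (\<lambda>x. indicator {0<..<1} x * (x powr (a - 1) * (1 - x) powr b * poly (jacobi01 a b m) x * poly p x))
     (poly p 0 * Beta a (b + real m + 1))"
proof -
  have "has_bochner_integral lborel
     (\<lambda>x. \<Sum>i\<le>m. coeff p i * (indicator {0<..<1} x *
        (x powr (a + real i - 1) * (1 - x) powr b * poly (jacobi01 a b m) x)))
     (\<Sum>i\<le>m. coeff p i * (Beta (a + real i) (b + real m + 1) * (a + real m - (a + real i) gchoose m)))"
    by (intro has_bochner_integral_sum has_bochner_integral_mult_right jacobi01_moment)
      (use a b in auto)
  also have "(\<lambda>x. \<Sum>i\<le>m. coeff p i * (indicator {0<..<1} x *
        (x powr (a + real i - 1) * (1 - x) powr b * poly (jacobi01 a b m) x)))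
    = (\<lambda>x. indicator {0<..<1} x * (x powr (a - 1) * (1 - x) powr b * poly (jacobi01 a b m) x * poly p x))"
    (is "?f = ?g")
  proof
    fix x :: real
    show "?f x = ?g x"
    proof (cases "x \<in> {0<..<1}")
      case True
      have "x powr (a + real i - 1) = x powr (a - 1) * x ^ i" for i
        using True powr_add[of x "a - 1" "real i"] by (simp add: powr_realpow algebra_simps)
      moreover have "poly p x = (\<Sum>i\<le>m. coeff p i * x ^ i)"
        using arg_cong[OF poly_as_sum_of_monoms'[OF deg], of "\<lambda>p. poly p x"]
        by (simp add: poly_sum poly_monom)
      ultimately show ?thesis
        using True by (simp add: sum_distrib_left mult_ac)
    qed simp
  qed
  also have "(\<Sum>i\<le>m. coeff p i * (Beta (a + real i) (b + real m + 1) * (a + real m - (a + real i) gchoose m)))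
      = (\<Sum>i\<le>m. if i = 0 then poly p 0 * Beta a (b + real m + 1) else 0)"
  proof (rule sum.cong)
    fix i assume i: "i \<in> {..m}"
    have "a + real m - (a + real i) = real (m - i)"
      using i by (simp add: of_nat_diff)
    then have "(a + real m - (a + real i) gchoose m) = real ((m - i) choose m)"
      by (simp only: binomial_gbinomial)
    also have "\<dots> = (if i = 0 then 1 else 0)"
      using i by (auto intro: binomial_eq_0)
    finally show "coeff p i * (Beta (a + real i) (b + real m + 1) * (a + real m - (a + real i) gchoose m))
        = (if i = 0 then poly p 0 * Beta a (b + real m + 1) else 0)"
      by (simp add: poly_0_coeff_0)
  qed simp
  finally show ?thesis by simp
qed

section \<open>Orthogonality and the norm\<close>

lemma alt_jacobi_integral:
  assumes \<alpha>: "\<alpha> > -1" and \<beta>: "\<beta> > -1" and "k \<le> l" and "l \<le> n"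
  shows "has_bochner_integral lborel
     (\<lambda>x. indicator {0<..<1} x * (x powr \<alpha> * (1 - x) powr \<beta> * alt_jacobi \<alpha> \<beta> n k x * alt_jacobi \<alpha> \<beta> n l x))
     (alt_jacobi_norm \<alpha> \<beta> n k * (if k = l then 1 else 0))"
proof -
  define a where "a = \<alpha> + 2 * real k + 1"
  define m where "m = n - k"
  define p where "p = monom 1 (l - k) * jacobi01 (\<alpha> + 2 * real l + 1) \<beta> (n - l)"
  have a: "a > 0" and n: "real n = real m + real k"
    using assms by (auto simp: a_def m_def of_nat_diff)
  have "degree p \<le> degree (monom 1 (l - k) :: real poly) + degree (jacobi01 (\<alpha> + 2 * real l + 1) \<beta> (n - l))"
    unfolding p_def by (rule degree_mult_le)
  also have "\<dots> \<le> (l - k) + (n - l)"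
    by (intro add_mono degree_monom_le degree_jacobi01)
  also have "\<dots> = m"
    using assms by (simp add: m_def)
  finally have "has_bochner_integral lborel
     (\<lambda>x. indicator {0<..<1} x * (x powr (a - 1) * (1 - x) powr \<beta> * poly (jacobi01 a \<beta> m) x * poly p x))
     (poly p 0 * Beta a (\<beta> + real m + 1))"
    by (intro jacobi01_integral a \<beta>)
  also have "(\<lambda>x. indicator {0<..<1} x * (x powr (a - 1) * (1 - x) powr \<beta> * poly (jacobi01 a \<beta> m) x * poly p x))
    = (\<lambda>x. indicator {0<..<1} x * (x powr \<alpha> * (1 - x) powr \<beta> * alt_jacobi \<alpha> \<beta> n k x * alt_jacobi \<alpha> \<beta> n l x))"
    (is "?f = ?g")
  proof
    fix x :: real
    show "?f x = ?g x"
    proof (cases "x \<in> {0<..<1}")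
      case True
      \<comment> \<open>One factor \<open>x ^ k\<close> belongs to the polynomial with index
        \<open>k\<close>, the other was split off from the one with index \<open>l\<close> to form
        \<open>p\<close>.\<close>
      have "x powr (a - 1) = x powr \<alpha> * x ^ (k + k)"
        using True powr_add[of x \<alpha> "real (k + k)"] powr_realpow[of x "k + k"]
        by (simp add: a_def)
      moreover have "x ^ l = x ^ k * x ^ (l - k)"
        using \<open>k \<le> l\<close> by (simp flip: power_add)
      ultimately show ?thesis
        using True assms by (simp add: alt_jacobi_eq_poly p_def poly_monom a_def m_def power_add)
    qed simp
  qed
  also have "poly p 0 * Beta a (\<beta> + real m + 1) = alt_jacobi_norm \<alpha> \<beta> n k * (if k = l then 1 else 0)"
  proof (cases "k = l")
    case False
    then show ?thesis
      using \<open>k \<le> l\<close> by (simp add: p_def poly_monom power_0_left)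
  next
    case True
    have p0: "poly p 0 = Gamma (a + real m + 1) / (Gamma (a + 1) * fact m)"
      using a True by (simp add: p_def poly_jacobi01_0 a_def m_def)
    \<comment> \<open>The \<open>Gamma a\<close> of the Beta value cancels against this, which
      leaves the factor 1/a = 1/(\<alpha> + 2k + 1) of the norm.\<close>
    have Suc: "Gamma (a + 1) = a * Gamma a"
      using a by (intro Gamma_plus1) (auto elim!: nonpos_Ints_cases)
    have "Gamma a \<noteq> 0"
      using Gamma_real_pos[OF a] by linarith
    moreover have "alt_jacobi_norm \<alpha> \<beta> n k =
        1 / a * (Gamma (a + real m + 1) * Gamma (\<beta> + real m + 1) / (fact m * Gamma (a + (\<beta> + real m + 1))))"
      unfolding alt_jacobi_norm_def m_def[symmetric] n a_def by (simp add: algebra_simps)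
    ultimately show ?thesis
      using a True unfolding p0 Suc Beta_def by (simp add: field_simps)
  qed
  finally show ?thesis .
qed

theorem theorem2p2:
  fixes \<alpha> \<beta> :: real and n k l :: nat
  assumes "\<alpha> > -1" and "\<beta> > -1" and "k \<le> n" and "l \<le> n"
  shows "set_integrable lborel {0<..<1}
           (\<lambda>x. x powr \<alpha> * (1 - x) powr \<beta> * alt_jacobi \<alpha> \<beta> n k x * alt_jacobi \<alpha> \<beta> n l x)
    \<and> (LBINT x:{0<..<1}. x powr \<alpha> * (1 - x) powr \<beta> * alt_jacobi \<alpha> \<beta> n k x * alt_jacobi \<alpha> \<beta> n l x)
           = alt_jacobi_norm \<alpha> \<beta> n k * (if k = l then 1 else 0)"
proof -
  have "has_bochner_integral lborel
     (\<lambda>x. indicator {0<..<1} x * (x powr \<alpha> * (1 - x) powr \<beta> * alt_jacobi \<alpha> \<beta> n k x * alt_jacobi \<alpha> \<beta> n l x))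
     (alt_jacobi_norm \<alpha> \<beta> n k * (if k = l then 1 else 0))"
  proof (cases "k \<le> l")
    case True
    then show ?thesis
      using assms by (intro alt_jacobi_integral)
  next
    \<comment> \<open>The integrand is symmetric in \<open>k\<close> and \<open>l\<close>. Swapping
      them changes the norm factor, but here \<open>k \<noteq> l\<close> and both right-hand sides
      are 0.\<close>
    case False
    then show ?thesis
      using alt_jacobi_integral[of \<alpha> \<beta> l k n] assms by (simp add: mult_ac)
  qed
  then show ?thesis
    by (simp add: has_bochner_integral_iff set_integrable_def set_lebesgue_integral_def)
qed

end
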